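(* Let $(g_n)_{n\ge 0}$ be the sequence defined by $g_0=19$ and $g_n-g_{n-1}=29\cdot 2^{2n-1}$ for all $n\ge 1$. Then $g_n=\frac{1}{3}\left[29\cdot 2^{2n+1}-1\right]$ for all $n\ge 0$; for every odd number in the set $\{g_n : n\ge 0\}$, repeated application of the Collatz function $f$ eventually reaches $1$; and for each $n\ge 0$ the number of Collatz function operations needed to get $1$ from $g_n$ is $N_{g_n}=N_{29}+2n+2$.
   Context: The Collatz function $f:\mathbb{Z}_{\ge 1}\to\mathbb{Z}_{\ge 1}$ is defined by $f(n)=n/2$ if $n$ is even and $f(n)=3n+1$ if $n$ is odd. For a positive integer $k$, $N_k$ denotes the number of Collatz function operations for the number $k$ to get $1$, i.e. the least integer $m\ge 1$ such that the $m$-fold iterate satisfies $f^{m}(k)=1$ (so that $N_1=3$, via $1\to 4\to 2\to 1$), with $N_k=\infty$ if there is no such $m$. *)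

theory Defs
  imports Complex_Main "HOL-Library.Extended_Nat"
begin

(* The Collatz map lives on the positive integers; the value at 0 is irrelevant,
   since positive arguments have positive values. *)
definition collatz :: "nat \<Rightarrow> nat" where
  "collatz n = (if even n then n div 2 else 3 * n + 1)"

(* The iteration count starts at m = 1, so the value at 1 is 3 (1, 4, 2, 1) and not 0. *)
definition collatz_steps :: "nat \<Rightarrow> enat" where
  "collatz_steps k =
    (if \<exists>m\<ge>1. (collatz ^^ m) k = 1
     then enat (LEAST m. m \<ge> 1 \<and> (collatz ^^ m) k = 1)
     else \<infinity>)"

end

theory Submission
  imports Defs
begin

text \<open>
  Summing the recurrence is the same as saying \<open>3 g\<^sub>n + 1 = 29 \<cdot> 2\<^bsup>2n+1\<^esup>\<close>, and this form
  carries the whole proof. It makes \<open>g\<^sub>n\<close> odd, and it says that the first Collatz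
  operation sends \<open>g\<^sub>n\<close> to \<open>29\<close> times a power of two; the next \<open>2n + 1\<close> operations are
  halvings that end in \<open>29\<close>. So \<open>29\<close> is reached after \<open>2n + 2\<close> operations, and since none of
  the intermediate values is \<open>1\<close>, the counts add up (\<open>collatz_steps_rec\<close>,
  \<open>collatz_steps_power_two_mult\<close>). The trajectory of \<open>29\<close> itself reaches \<open>1\<close> by computation.
\<close>

lemma collatz_steps_finite_iff:
  "collatz_steps k \<noteq> \<infinity> \<longleftrightarrow> (\<exists>m\<ge>1. (collatz ^^ m) k = 1)"
  by (simp add: collatz_steps_def)

text \<open>
  Shifting the index by one matches the operation counts at which \<open>k\<close> is at \<open>1\<close> with those
  at which its successor is, except that the count \<open>1\<close> for \<open>k\<close> would correspond to the
  count \<open>0\<close>, which is excluded; the assumption rules out this case. It matters: for \<open>k = 2\<close>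
  the count is \<open>1\<close>, but for its successor \<open>1\<close> it is \<open>3\<close>.
\<close>

lemma collatz_steps_rec:
  assumes "collatz k \<noteq> 1"
  shows "collatz_steps k = eSuc (collatz_steps (collatz k))"
proof -
  define P where "P \<equiv> \<lambda>j m. m \<ge> 1 \<and> (collatz ^^ m) j = 1"
  have steps: "collatz_steps j = (if \<exists>m. P j m then enat (LEAST m. P j m) else \<infinity>)" for j
    by (simp add: collatz_steps_def P_def)
  have not_0: "\<not> P k 0"
    by (simp add: P_def)
  have shift: "P k (Suc m) \<longleftrightarrow> P (collatz k) m" for m
    using assms by (cases m) (simp_all add: P_def funpow_swap1)
  have ex: "(\<exists>m. P k m) \<longleftrightarrow> (\<exists>m. P (collatz k) m)"
    using not_0 shift by (metis not0_implies_Suc)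
  show ?thesis
  proof (cases "\<exists>m. P k m")
    case True
    then obtain m where "P k m" by blast
    then have "(LEAST m. P k m) = Suc (LEAST m. P (collatz k) m)"
      using Least_Suc[of "P k" m] not_0 shift by simp
    then show ?thesis
      using True ex by (simp add: steps eSuc_enat)
  next
    case False
    then show ?thesis
      using ex by (simp add: steps)
  qed
qed

lemma collatz_steps_power_two_mult:
  assumes "a > 1"
  shows "collatz_steps (a * 2 ^ j) = collatz_steps a + enat j"
proof (induction j)
  case 0
  show ?case by (simp add: zero_enat_def[symmetric])
next
  case (Suc j)
  have half: "collatz (a * 2 ^ Suc j) = a * 2 ^ j"
    by (simp add: collatz_def)
  have "a * 2 ^ j \<noteq> 1"
    using assms by simp
  then show ?case
    using collatz_steps_rec[of "a * 2 ^ Suc j"]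
    unfolding half Suc.IH by (simp add: iadd_Suc_right flip: eSuc_enat)
qed

lemma collatz_steps_29_finite: "collatz_steps 29 \<noteq> \<infinity>"
proof -
  \<comment> \<open>29, 88, 44, 22, 11, 34, 17, 52, 26, 13, 40, 20, 10, 5, 16, 8, 4, 2, 1\<close>
  \<comment> \<open>Peeling off the innermost application keeps the argument of each \<open>collatz\<close> a numeral,
     so that every step is evaluated before the next one.\<close>
  have unroll: "(collatz ^^ numeral v) x = (collatz ^^ pred_numeral v) (collatz x)" for v x
    by (simp only: numeral_eq_Suc funpow_Suc_right o_apply)
  have "(collatz ^^ 18) 29 = 1"
    by (simp add: unroll collatz_def)
  then show ?thesis
    unfolding collatz_steps_finite_iff by (intro exI[of _ 18]) simp
qed

lemma three_mult_add_one_of_recurrence: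
  fixes g :: "nat \<Rightarrow> nat"
  assumes "g 0 = 19"
    and "\<forall>n\<ge>1. int (g n) - int (g (n - 1)) = 29 * 2 ^ (2 * n - 1)"
  shows "3 * g n + 1 = 29 * 2 ^ (2 * n + 1)"
proof -
  have "3 * int (g n) + 1 = 29 * 2 ^ (2 * n + 1)"
  proof (induction n)
    case 0
    show ?case using assms(1) by simp
  next
    case (Suc n)
    have "int (g (Suc n)) = int (g n) + 29 * 2 ^ (2 * n + 1)"
      using assms(2)[rule_format, of "Suc n"] by simp
    then show ?case
      using Suc.IH by simp
  qed
  then have "int (3 * g n + 1) = int (29 * 2 ^ (2 * n + 1))"
    by simp
  then show ?thesis
    by (simp only: of_nat_eq_iff)
qed

theorem theorem7:
  fixes g :: "nat \<Rightarrow> nat"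
  assumes "g 0 = 19"
    and "\<forall>n\<ge>1. int (g n) - int (g (n - 1)) = 29 * 2 ^ (2 * n - 1)"
  shows "(\<forall>n. real (g n) = 1 / 3 * (29 * 2 ^ (2 * n + 1) - 1)) \<and>
    (\<forall>x\<in>range g. odd x \<longrightarrow> (\<exists>m\<ge>1. (collatz ^^ m) x = 1)) \<and>
    (\<forall>n. collatz_steps (g n) = collatz_steps 29 + enat (2 * n + 2))"
proof -
  have key: "3 * g n + 1 = 29 * 2 ^ (2 * n + 1)" for n
    using three_mult_add_one_of_recurrence[OF assms] .
  have closed_form: "real (g n) = 1 / 3 * (29 * 2 ^ (2 * n + 1) - 1)" for n
  proof -
    have "real (3 * g n + 1) = real (29 * 2 ^ (2 * n + 1))"
      by (simp only: key)
    then show ?thesis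
      by simp
  qed
  have steps: "collatz_steps (g n) = collatz_steps 29 + enat (2 * n + 2)" for n
  proof -
    have "even (3 * g n + 1)"
      unfolding key by simp
    then have first: "collatz (g n) = 29 * 2 ^ (2 * n + 1)"
      using key[of n] by (simp add: collatz_def)
    have "collatz (g n) \<noteq> 1"
      unfolding first by simp
    then have "collatz_steps (g n) = eSuc (collatz_steps (29 * 2 ^ (2 * n + 1)))"
      using collatz_steps_rec first by simp
    also have "\<dots> = eSuc (collatz_steps 29 + enat (2 * n + 1))"
      by (subst collatz_steps_power_two_mult) simp_all
    also have "\<dots> = collatz_steps 29 + enat (2 * n + 2)"
      by (simp add: iadd_Suc_right[symmetric] eSuc_enat)
    finally show ?thesis .
  qed
  have reaches_1: "\<exists>m\<ge>1. (collatz ^^ m) (g n) = 1" for n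
  proof -
    have "collatz_steps (g n) \<noteq> \<infinity>"
      unfolding steps using collatz_steps_29_finite by (simp add: plus_eq_infty_iff_enat)
    then show ?thesis
      unfolding collatz_steps_finite_iff .
  qed
  show ?thesis
    using closed_form reaches_1 steps by blast
qed

end
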